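(* Let $G$ be a simple graph which either has at least three vertices (connected or not) or is the disconnected graph on two vertices. Then $\pi_s(G) = \pi(G)$, where $\pi(G)$ is the pebbling number and $\pi_s(G)$ is the singular pebbling number of $G$ (both values may be $\infty$, in which case the equality means that both are infinite).
   Context: All graphs are simple (no loops and no multiple edges). A configuration of $t$ pebbles on $G$ is a function $C : V(G) \to \{0,1,2,\dots\}$ with $\sum_{v} C(v) = t$; $C(v)$ is the number of pebbles on $v$. A pebbling move consists of choosing a vertex $u$ carrying at least two pebbles and a vertex $v$ adjacent to $u$, taking two pebbles off $u$, placing one of them on $v$ and removing the other from the game. Pebbling moves are applied in finite (possibly empty) sequences. The pebbling number $\pi(G)$ is the smallest $t$ such that, for every configuration of $t$ pebbles on $G$ and every vertex $r$ (the target vertex), there is a finite sequence of pebbling moves after which at least one pebble is on $r$. If no such $t$ exists, $\pi(G) = \infty$. The singular pebbling number $\pi_s(G)$ is the smallest $t$ such that, for every configuration of at least $t$ pebbles on $G$ and every target vertex $r$, there is a finite sequence of pebbling moves after which exactly one pebble is on $r$. If no such $t$ exists, $\pi_s(G) = \infty$. *)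

theory Defs
  imports "Graph_Theory.Digraph_Component" "HOL-Library.Extended_Nat"
begin

text \<open>
  An undirected edge is encoded, as usual in this library, by its two orientations as arcs. The
  vertex set may be infinite; adding finiteness would give the locale \<^locale>\<open>graph\<close>.
\<close>

definition simple_graph :: "('a, 'b) pre_digraph \<Rightarrow> bool" where
  "simple_graph G \<longleftrightarrow> loopfree_digraph G \<and> nomulti_digraph G \<and> sym_digraph G"

text \<open>
  The sum is taken over the support, which has to be finite: a sum over an infinite set of
  vertices would be 0 by convention.
\<close>

definition configuration :: "('a, 'b) pre_digraph \<Rightarrow> nat \<Rightarrow> ('a \<Rightarrow> nat) \<Rightarrow> bool" where
  "configuration G t C \<longleftrightarrow>
     {v. C v \<noteq> 0} \<subseteq> verts G \<and> finite {v. C v \<noteq> 0} \<and> (\<Sum>v | C v \<noteq> 0. C v) = t"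

definition pebbling_move ::
  "('a, 'b) pre_digraph \<Rightarrow> ('a \<Rightarrow> nat) \<Rightarrow> ('a \<Rightarrow> nat) \<Rightarrow> bool" where
  "pebbling_move G C C' \<longleftrightarrow>
     (\<exists>u v. u \<rightarrow>\<^bsub>G\<^esub> v \<and> 2 \<le> C u \<and> C' = C(u := C u - 2, v := C v + 1))"

definition pebbling_reachable ::
  "('a, 'b) pre_digraph \<Rightarrow> ('a \<Rightarrow> nat) \<Rightarrow> ('a \<Rightarrow> nat) \<Rightarrow> bool" where
  "pebbling_reachable G = (pebbling_move G)\<^sup>*\<^sup>*"

definition smallest_or_infinity :: "(nat \<Rightarrow> bool) \<Rightarrow> enat" where
  "smallest_or_infinity P = (if \<exists>t. P t then enat (LEAST t. P t) else \<infinity>)"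

definition pebbling_number :: "('a, 'b) pre_digraph \<Rightarrow> enat" where
  "pebbling_number G = smallest_or_infinity (\<lambda>t.
     \<forall>C. configuration G t C \<longrightarrow>
       (\<forall>r \<in> verts G. \<exists>C'. pebbling_reachable G C C' \<and> C' r \<ge> 1))"

definition singular_pebbling_number :: "('a, 'b) pre_digraph \<Rightarrow> enat" where
  "singular_pebbling_number G = smallest_or_infinity (\<lambda>t.
     \<forall>s C. s \<ge> t \<and> configuration G s C \<longrightarrow>
       (\<forall>r \<in> verts G. \<exists>C'. pebbling_reachable G C C' \<and> C' r = 1))"

end

theory Submission
  imports Defs
begin

text \<open>
  Write $P(t)$ and $Q(t)$ for the properties whose least witnesses are the two numbers; in fact
  $P(t)$ and $Q(t)$ are equivalent for every $t$. If the target $r$ is empty, the first pebble to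
  arrive there is alone. If $r$ carries an odd number of pebbles, pairs of them are moved to a
  neighbour, and an even number that is at least 4 becomes odd by moving two pairs to a neighbour
  and one pebble back. What remains is a configuration $D$ together with two pebbles on $r$, where
  $D$ is empty on $r$; it has a pebble on some $x$, because $P(2)$ fails with three vertices (put
  single pebbles on the two that are not $r$), and on two isolated vertices every $P(t)$ fails.
  By $P(t)$, $D$ with two further pebbles on $x$
  can bring two pebbles to some neighbour $v$ of $r$. The initial pebbles split into two parts
  that each bring one of these, and as $D(x) \<ge> 1$, one of the parts is contained in $D$. So $D$
  alone brings a pebble to $v$; joined there by one from $r$, it brings a single pebble back to $r$. (If $D$ visits $r$ on its
  way to $v$, then $r$ carries 3 pebbles at that moment, which is odd.)
\<close>

section \<open>Reachability and added pebbles\<close>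

lemma pebbling_reachable_refl [simp]: "pebbling_reachable G C C"
  by (simp add: pebbling_reachable_def)

lemma pebbling_reachable_trans:
  "pebbling_reachable G C D \<Longrightarrow> pebbling_reachable G D E \<Longrightarrow> pebbling_reachable G C E"
  by (simp add: pebbling_reachable_def)

lemma pebbling_reachable_move:
  assumes "pebbling_reachable G C D" "u \<rightarrow>\<^bsub>G\<^esub> v" "2 \<le> D u"
  shows "pebbling_reachable G C (D(u := D u - 2, v := D v + 1))"
  using assms unfolding pebbling_reachable_def pebbling_move_def
  by (blast intro: rtranclp.rtrancl_into_rtrancl)

lemma pebbling_reachable_add:
  assumes "pebbling_reachable G C C'"
  shows "pebbling_reachable G (\<lambda>v. C v + D v) (\<lambda>v. C' v + D v)"
  using assms unfolding pebbling_reachable_def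
proof (induction rule: rtranclp_induct)
  case (step E F)
  then obtain u v where "u \<rightarrow>\<^bsub>G\<^esub> v" "2 \<le> E u" "F = E(u := E u - 2, v := E v + 1)"
    unfolding pebbling_move_def by blast
  then have "pebbling_move G (\<lambda>v. E v + D v) (\<lambda>v. F v + D v)"
    unfolding pebbling_move_def by (intro exI[of _ u] exI[of _ v]) auto
  with step.IH show ?case by (rule rtranclp.rtrancl_into_rtrancl[of "pebbling_move G"])
qed simp

lemma pebbling_reachable_mono:
  assumes "pebbling_reachable G C C'" "C \<le> D"
  obtains D' where "pebbling_reachable G D D'" "C' \<le> D'"
proof
  have "(\<lambda>v. C v + (D v - C v)) = D"
    using assms(2) by (auto simp: le_fun_def)
  then show "pebbling_reachable G D (\<lambda>v. C' v + (D v - C v))"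
    using pebbling_reachable_add[OF assms(1), of "\<lambda>v. D v - C v"] by simp
qed (simp add: le_fun_def)

section \<open>Splitting a sequence of moves between two groups of pebbles\<close>

lemma pebbling_move_split_left:
  assumes "u \<rightarrow>\<^bsub>G\<^esub> v" "u \<noteq> v" "2 \<le> C u" "C(u := C u - 2, v := C v + 1) = (\<lambda>w. A w + B w)"
    and "1 \<le> A v"
  obtains A' where "C = (\<lambda>w. A' w + B w)" "pebbling_move G A' A"
proof
  \<comment> \<open>A pebble on \<open>v\<close> is charged to \<open>A\<close>, so \<open>A\<close>
    gets back both pebbles taken off \<open>u\<close>; \<open>B\<close> is unchanged.\<close>
  let ?A = "A(u := A u + 2, v := A v - 1)"
  have eq: "(C(u := C u - 2, v := C v + 1)) w = A w + B w" for w
    using assms(4) by simp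
  show "C = (\<lambda>w. ?A w + B w)"
  proof
    fix w show "C w = ?A w + B w"
      using eq[of w] assms(2,3,5) by (auto split: if_splits)
  qed
  show "pebbling_move G ?A A"
    unfolding pebbling_move_def
    using assms(1,2,5) by (intro exI[of _ u] exI[of _ v]) auto
qed

text \<open>The moves are undone from the last to the first: the pebble that a move puts down can be
  assigned to one of the two parts, and this part pays for the whole move.\<close>

lemma pebbling_reachable_split:
  assumes "loopfree_digraph G" "pebbling_reachable G C C'" "C' = (\<lambda>v. A' v + B' v)"
  obtains A B where "C = (\<lambda>v. A v + B v)" "pebbling_reachable G A A'" "pebbling_reachable G B B'"
proof -
  have "\<exists>A B. C = (\<lambda>v. A v + B v) \<and> (pebbling_move G)\<^sup>*\<^sup>* A A' \<and> (pebbling_move G)\<^sup>*\<^sup>* B B'"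
    using assms(2) unfolding pebbling_reachable_def
  proof (induction rule: converse_rtranclp_induct)
    case base
    show ?case using assms(3) by blast
  next
    case (step C D)
    then obtain A B where D: "D = (\<lambda>v. A v + B v)"
      and A: "(pebbling_move G)\<^sup>*\<^sup>* A A'" and B: "(pebbling_move G)\<^sup>*\<^sup>* B B'" by blast
    from step.hyps(1) obtain u v where uv: "u \<rightarrow>\<^bsub>G\<^esub> v" "2 \<le> C u"
      and D_def: "D = C(u := C u - 2, v := C v + 1)"
      unfolding pebbling_move_def by blast
    have "u \<noteq> v"
      using uv(1) loopfree_digraph.adj_not_same[OF assms(1)] by blast
    have "D v = C v + 1" using D_def by simp
    then consider "1 \<le> A v" | "1 \<le> B v" using D by force
    then show ?case
    proof cases
      case 1
      then obtain A0 where "C = (\<lambda>w. A0 w + B w)" "pebbling_move G A0 A"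
        using pebbling_move_split_left[OF uv(1) \<open>u \<noteq> v\<close>, of C A B] uv(2) D D_def by metis
      then show ?thesis using A B by (blast intro: converse_rtranclp_into_rtranclp)
    next
      case 2
      have "C(u := C u - 2, v := C v + 1) = (\<lambda>w. B w + A w)"
        using D D_def by (simp add: add.commute)
      from pebbling_move_split_left[OF uv(1) \<open>u \<noteq> v\<close>, of C B A, OF uv(2) this 2]
      obtain B0 where "C = (\<lambda>w. B0 w + A w)" "pebbling_move G B0 B" .
      then have "C = (\<lambda>w. A w + B0 w)" by (simp add: add.commute)
      then show ?thesis
        using A B \<open>pebbling_move G B0 B\<close> by (blast intro: converse_rtranclp_into_rtranclp)
    qed
  qed
  then show ?thesis using that unfolding pebbling_reachable_def by blast
qed

section \<open>Arrivals at the target and the parity of its pebbles\<close>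

text \<open>Only a move into \<open>r\<close> can end its being empty. The state just before it
  gives a neighbour of \<open>r\<close> and a pair of pebbles there.\<close>

lemma pebbling_reachable_before_first_arrival:
  assumes "pebbling_reachable G C C'" "C r = 0" "C' r \<ge> 1"
  obtains D u where "pebbling_reachable G C D" "D r = 0" "u \<rightarrow>\<^bsub>G\<^esub> r" "2 \<le> D u"
proof -
  have "\<exists>D u. (pebbling_move G)\<^sup>*\<^sup>* C D \<and> D r = 0 \<and> u \<rightarrow>\<^bsub>G\<^esub> r \<and> 2 \<le> D u"
    using assms unfolding pebbling_reachable_def
  proof (induction rule: rtranclp_induct)
    case (step D E)
    show ?case
    proof (cases "D r = 0")
      case True
      from step.hyps(2) obtain u v where "u \<rightarrow>\<^bsub>G\<^esub> v" "2 \<le> D u" "E = D(u := D u - 2, v := D v + 1)"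
        unfolding pebbling_move_def by blast
      moreover from this have "v = r"
        using True step.prems(2) by (auto split: if_splits)
      ultimately show ?thesis using True step.hyps(1) by blast
    next
      case False
      then show ?thesis using step.IH step.prems(1) by simp
    qed
  qed simp
  then show ?thesis using that unfolding pebbling_reachable_def by blast
qed

lemma pebbling_reachable_exactly_one:
  assumes "pebbling_reachable G C C'" "C r = 0" "C' r \<ge> 1"
  obtains D where "pebbling_reachable G C D" "D r = 1"
proof -
  obtain D u where D: "pebbling_reachable G C D" "D r = 0" "u \<rightarrow>\<^bsub>G\<^esub> r" "2 \<le> D u"
    using pebbling_reachable_before_first_arrival[OF assms] by metis
  show ?thesis
    using that[OF pebbling_reachable_move[OF D(1,3,4)]] D(2) by simp
qed

lemma pebbling_reachable_drain:
  assumes "r \<rightarrow>\<^bsub>G\<^esub> v" "r \<noteq> v" "C r = m + 2 * k"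
  obtains C' where "pebbling_reachable G C C'" "C' r = m" "C' v = C v + k"
proof -
  have "\<exists>C'. pebbling_reachable G C C' \<and> C' r = m \<and> C' v = C v + k"
    using assms(3)
  proof (induction k arbitrary: m)
    case 0
    then show ?case by (intro exI[of _ C]) simp
  next
    case (Suc k)
    \<comment> \<open>The induction covers all \<open>m\<close>, because the first \<open>k\<close>
      moves must leave two more pebbles on \<open>r\<close> for the last one.\<close>
    have "C r = (m + 2) + 2 * k" using Suc.prems by simp
    from Suc.IH[OF this] obtain C'
      where C': "pebbling_reachable G C C'" "C' r = m + 2" "C' v = C v + k" by blast
    define D where "D = C'(r := C' r - 2, v := C' v + 1)"
    have "pebbling_reachable G C D"
      unfolding D_def using C' assms(1) by (intro pebbling_reachable_move) auto
    moreover have "D r = m" "D v = C v + Suc k"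
      using C' assms(2) by (simp_all add: D_def)
    ultimately show ?case by blast
  qed
  then show ?thesis using that by blast
qed

lemma pebbling_reachable_odd:
  assumes "r \<rightarrow>\<^bsub>G\<^esub> v" "r \<noteq> v" "odd (C r)"
  obtains C' where "pebbling_reachable G C C'" "C' r = 1"
proof -
  from assms(3) obtain k where "C r = 2 * k + 1" by (rule oddE)
  then have "C r = 1 + 2 * k" by simp
  from pebbling_reachable_drain[OF assms(1,2), of C 1 k, OF this] show ?thesis using that .
qed

lemma pebbling_reachable_even:
  assumes "r \<rightarrow>\<^bsub>G\<^esub> v" "v \<rightarrow>\<^bsub>G\<^esub> r" "r \<noteq> v" "even (C r)" "4 \<le> C r"
  obtains C' where "pebbling_reachable G C C'" "C' r = 1"
proof -
  define m where "m = C r - 4"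
  have m: "C r = m + 2 * 2" "even m" using assms(4,5) by (auto simp: m_def)
  obtain D where D: "pebbling_reachable G C D" "D r = m" "D v = C v + 2"
    using pebbling_reachable_drain[OF assms(1,3), of C m 2, OF m(1)] .
  \<comment> \<open>The two pebbles that came to \<open>v\<close> pay for one pebble back, which
    flips the parity on \<open>r\<close>.\<close>
  let ?E = "D(v := D v - 2, r := D r + 1)"
  have E: "pebbling_reachable G C ?E"
    using D assms(2) by (intro pebbling_reachable_move) auto
  have "odd (?E r)" using D(2) m(2) by simp
  then show ?thesis
    using pebbling_reachable_odd[OF assms(1,3)] pebbling_reachable_trans[OF E] that by metis
qed

section \<open>Solvable numbers of pebbles\<close>

text \<open>The property $P(t)$ of the overview, whose least witness is
  \<open>pebbling_number\<close>.\<close>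

definition pebbling_solvable :: "('a, 'b) pre_digraph \<Rightarrow> nat \<Rightarrow> bool" where
  "pebbling_solvable G t \<longleftrightarrow> (\<forall>C. configuration G t C \<longrightarrow>
     (\<forall>r \<in> verts G. \<exists>C'. pebbling_reachable G C C' \<and> C' r \<ge> 1))"

text \<open>Any finite set of vertices containing the support may carry the sum, so the exact
  support of an updated function need not be computed.\<close>

lemma configurationI:
  assumes "finite S" "S \<subseteq> verts G" "\<And>v. v \<notin> S \<Longrightarrow> C v = 0" "sum C S = t"
  shows "configuration G t C"
proof -
  have sub: "{v. C v \<noteq> 0} \<subseteq> S"
  proof
    fix v assume "v \<in> {v. C v \<noteq> 0}"
    then show "v \<in> S" using assms(3)[of v] by (cases "v \<in> S") simp_all
  qed
  have "(\<Sum>v | C v \<noteq> 0. C v) = sum C S"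
    using assms(1) sub by (intro sum.mono_neutral_left) auto
  then show ?thesis
    using assms(2,4) sub finite_subset[OF sub assms(1)] unfolding configuration_def by simp
qed

lemma configuration_remove_one:
  assumes "configuration G (Suc s) C"
  obtains D where "configuration G s D" "D \<le> C"
proof -
  let ?S = "{v. C v \<noteq> 0}"
  have S: "finite ?S" "?S \<subseteq> verts G" "sum C ?S = Suc s"
    using assms by (auto simp: configuration_def)
  then obtain x where x: "x \<in> ?S" by (metis sum.empty ex_in_conv nat.distinct(1))
  let ?D = "C(x := C x - 1)"
  have "sum C ?S = C x + sum C (?S - {x})" "sum ?D ?S = ?D x + sum ?D (?S - {x})"
    using S(1) x by (simp_all only: sum.remove)
  moreover have "sum ?D (?S - {x}) = sum C (?S - {x})" by (rule sum.cong) auto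
  moreover have "C x \<noteq> 0" using x by simp
  ultimately have "sum ?D ?S = s" using S(3) by auto
  then have "configuration G s ?D"
    using S x by (intro configurationI[of ?S]) auto
  then show ?thesis by (rule that) (simp add: le_fun_def)
qed

text \<open>A surplus pebble is set aside and cannot hinder the others. This bridges exactly
  \<open>t\<close> pebbles in $P(t)$ and at least \<open>t\<close> in $Q(t)$.\<close>

lemma pebbling_solvable_mono:
  assumes "s \<ge> t" "pebbling_solvable G t"
  shows "pebbling_solvable G s"
  using assms
proof (induction rule: dec_induct)
  case (step s)
  show ?case
    unfolding pebbling_solvable_def
  proof (intro allI impI ballI)
    fix C r
    assume "configuration G (Suc s) C" "r \<in> verts G"
    obtain D where D: "configuration G s D" "D \<le> C"
      using configuration_remove_one[OF \<open>configuration G (Suc s) C\<close>] .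
    with step \<open>r \<in> verts G\<close> obtain D' where D': "pebbling_reachable G D D'" "1 \<le> D' r"
      unfolding pebbling_solvable_def by blast
    obtain C' where C': "pebbling_reachable G C C'" "D' \<le> C'"
      using pebbling_reachable_mono[OF D'(1) D(2)] .
    then show "\<exists>C'. pebbling_reachable G C C' \<and> 1 \<le> C' r"
      using D'(2) by (meson le_funD order_trans)
  qed
qed simp

text \<open>With all pebbles on \<open>w\<close>, the first one to reach \<open>r\<close> must come
  along an edge.\<close>

lemma pebbling_solvable_imp_adj:
  assumes "pebbling_solvable G t" "r \<in> verts G" "w \<in> verts G" "r \<noteq> w"
  obtains v where "v \<rightarrow>\<^bsub>G\<^esub> r"
proof -
  let ?C = "(\<lambda>_. 0)(w := t)"
  have "configuration G t ?C"
    using assms(3) by (intro configurationI[of "{w}"]) auto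
  then obtain C' where "pebbling_reachable G ?C C'" "C' r \<ge> 1"
    using assms(1,2) unfolding pebbling_solvable_def by blast
  then show ?thesis
    using pebbling_reachable_before_first_arrival[of G ?C C' r] assms(4) that by auto
qed

lemma not_pebbling_solvable_2:
  assumes "{r, a, b} \<subseteq> verts G" "distinct [r, a, b]"
  shows "\<not> pebbling_solvable G 2"
proof
  assume solvable: "pebbling_solvable G 2"
  let ?C = "(\<lambda>_. 0::nat)(a := 1, b := 1)"
  have "configuration G 2 ?C"
    using assms by (intro configurationI[of "{a, b}"]) auto
  then obtain C' where C': "pebbling_reachable G ?C C'" "C' r \<ge> 1"
    using assms(1) solvable unfolding pebbling_solvable_def by blast
  \<comment> \<open>No vertex carries two pebbles, so nothing can move.\<close>
  have "\<not> pebbling_move G ?C D" for D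
    unfolding pebbling_move_def by auto
  then have "C' = ?C"
    using C'(1) unfolding pebbling_reachable_def by (metis converse_rtranclpE)
  then show False using C'(2) assms(2) by auto
qed

section \<open>Leaving one pebble on the target\<close>

lemma exactly_one_of_two_on_target:
  assumes G: "sym_digraph G" "loopfree_digraph G" and solvable: "pebbling_solvable G s"
    and C: "configuration G s C" "C r = 2" "C x \<ge> 1" "x \<noteq> r" and r: "r \<in> verts G"
  shows "\<exists>C'. pebbling_reachable G C C' \<and> C' r = 1"
proof -
  define D where "D = C(r := 0)"
  \<comment> \<open>The pair on \<open>r\<close> is relocated to \<open>x\<close>: the total stays
    \<open>s\<close>, so \<open>solvable\<close> applies, and now \<open>r\<close> is empty.\<close>
  define F where "F = D(x := D x + 2)"
  have C_eq: "C = (\<lambda>v. D v + ((\<lambda>_. 0)(r := 2)) v)"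
    using C(2) by (auto simp: D_def)
  have F_r: "F r = 0" using C(4) by (simp add: F_def D_def)
  have "configuration G s F"
  proof (rule configurationI[of "{v. C v \<noteq> 0}"])
    let ?S = "{v. C v \<noteq> 0}"
    let ?R = "?S - {r} - {x}"
    have S: "finite ?S" "?S \<subseteq> verts G" "sum C ?S = s"
      using C(1) by (auto simp: configuration_def)
    show "finite ?S" "?S \<subseteq> verts G" by fact+
    show "F v = 0" if "v \<notin> ?S" for v
      using that C by (auto simp: F_def D_def)
    have sum_split: "sum g ?S = g r + (g x + sum g ?R)" for g :: "'a \<Rightarrow> nat"
    proof -
      have "sum g ?S = g r + sum g (?S - {r})" using S(1) C by (intro sum.remove) auto
      also have "sum g (?S - {r}) = g x + sum g ?R" using S(1) C by (intro sum.remove) auto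
      finally show ?thesis .
    qed
    have "sum F ?R = sum C ?R" by (rule sum.cong) (auto simp: F_def D_def)
    then show "sum F ?S = s"
      using sum_split[of F] sum_split[of C] S(3) C by (simp add: F_def D_def)
  qed
  then obtain F0 where "pebbling_reachable G F F0" "F0 r \<ge> 1"
    using solvable r unfolding pebbling_solvable_def by blast
  then obtain F' v where F': "pebbling_reachable G F F'" "v \<rightarrow>\<^bsub>G\<^esub> r" "2 \<le> F' v"
    using pebbling_reachable_before_first_arrival F_r by metis
  have adj: "r \<rightarrow>\<^bsub>G\<^esub> v" "r \<noteq> v"
    using F'(2) sym_digraph.graph_symmetric[OF G(1)] loopfree_digraph.adj_not_same[OF G(2)] by blast+
  have D_brings: "\<exists>D'. pebbling_reachable G D D' \<and> 1 \<le> D' v"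
    if "A \<le> D" "pebbling_reachable G A A'" "1 \<le> A' v" for A A'
    by (metis that pebbling_reachable_mono le_funD order_trans)
  obtain D' where D': "pebbling_reachable G D D'" "1 \<le> D' v"
  proof -
    \<comment> \<open>One pebble on \<open>v\<close> is split off; as \<open>F' v\<close> is at
      least 2, the rest has another one there.\<close>
    have "F' = (\<lambda>w. ((\<lambda>_. 0)(v := 1)) w + (F'(v := F' v - 1)) w)"
      using F'(3) by auto
    from pebbling_reachable_split[OF G(2) F'(1) this] obtain A B where
      F_eq: "F = (\<lambda>w. A w + B w)" and
      A: "pebbling_reachable G A ((\<lambda>_. 0)(v := 1))" and
      B: "pebbling_reachable G B (F'(v := F' v - 1))" .
    have le: "A w \<le> D w" "B w \<le> D w" if "w \<noteq> x" for w
      using fun_cong[OF F_eq, of w] that by (auto simp: F_def)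
    have "A x + B x = D x + 2" "D x \<ge> 1"
      using fun_cong[OF F_eq, of x] C(3,4) by (auto simp: F_def D_def)
    \<comment> \<open>If both parts exceeded \<open>D x\<close> at \<open>x\<close>, they would have
      at least \<open>2 * D x + 2\<close> pebbles there, more than \<open>D x + 2\<close>.\<close>
    then consider "A x \<le> D x" | "B x \<le> D x" by linarith
    then have "A \<le> D \<or> B \<le> D"
      by cases (metis le le_funI)+
    then show ?thesis using D_brings A B F'(3) that by fastforce
  qed
  let ?E = "\<lambda>w. D' w + ((\<lambda>_. 0)(r := 2)) w"
  have E: "pebbling_reachable G C ?E"
    using pebbling_reachable_add[OF D'(1)] C_eq by simp
  show ?thesis
  proof (cases "D' r = 0")
    case True
    \<comment> \<open>Here \<open>r\<close> carries just its initial pair. Sending it to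
      \<open>v\<close> empties \<open>r\<close> and leaves at least two pebbles on \<open>v\<close>,
      enough for one back.\<close>
    then have "?E r = 0 + 2 * 1" by simp
    from pebbling_reachable_drain[OF adj, of ?E 0 1, OF this] obtain H
      where H: "pebbling_reachable G ?E H" "H r = 0" "H v = ?E v + 1" .
    have "pebbling_reachable G ?E (H(v := H v - 2, r := H r + 1))"
      using H D'(2) F'(2) by (intro pebbling_reachable_move) auto
    then show ?thesis using pebbling_reachable_trans[OF E] H(2) by fastforce
  next
    case False
    \<comment> \<open>\<open>D\<close> is empty on \<open>r\<close>, so its moves can stop at a
      single pebble there, which makes 3 with the pair.\<close>
    then obtain D1 where "pebbling_reachable G D D1" "D1 r = 1"
      using pebbling_reachable_exactly_one[OF D'(1), of r] by (auto simp: D_def)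
    then have "pebbling_reachable G C (\<lambda>w. D1 w + ((\<lambda>_. 0)(r := 2)) w)"
      using pebbling_reachable_add[of G D D1] C_eq by simp
    moreover have "odd (D1 r + ((\<lambda>_. 0)(r := 2)) r)" using \<open>D1 r = 1\<close> by simp
    ultimately show ?thesis
      using pebbling_reachable_odd[OF adj, of "\<lambda>w. D1 w + ((\<lambda>_. 0)(r := 2)) w"]
        pebbling_reachable_trans by metis
  qed
qed

text \<open>The cases follow \<open>C r\<close>. The hypothesis \<open>two\<close> excludes a
  configuration that is just a pair on \<open>r\<close>; \<open>w\<close> ensures that
  \<open>r\<close> has a neighbour.\<close>

lemma exactly_one_on_target:
  assumes G: "sym_digraph G" "loopfree_digraph G" and solvable: "pebbling_solvable G s"
    and two: "\<not> pebbling_solvable G 2"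
    and C: "configuration G s C" and r: "r \<in> verts G" and w: "w \<in> verts G" "w \<noteq> r"
  shows "\<exists>C'. pebbling_reachable G C C' \<and> C' r = 1"
proof -
  obtain v where v: "v \<rightarrow>\<^bsub>G\<^esub> r"
    using pebbling_solvable_imp_adj solvable r w by metis
  then have adj: "r \<rightarrow>\<^bsub>G\<^esub> v" "r \<noteq> v"
    using sym_digraph.graph_symmetric[OF G(1)] loopfree_digraph.adj_not_same[OF G(2)] by blast+
  consider "C r = 0" | "odd (C r)" | "even (C r)" "4 \<le> C r" | "C r = 2"
  proof -
    have "C r = 0 \<or> C r = 1 \<or> C r = 2 \<or> C r = 3 \<or> 4 \<le> C r" by linarith
    then show thesis using that by (cases "even (C r)") auto
  qed
  then show ?thesis
  proof cases
    case 1
    then show ?thesis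
      using solvable C r pebbling_reachable_exactly_one unfolding pebbling_solvable_def by metis
  next
    case 2
    then show ?thesis using pebbling_reachable_odd[OF adj] by metis
  next
    case 3
    then show ?thesis using pebbling_reachable_even[OF adj(1) v adj(2)] by metis
  next
    case 4
    show ?thesis
    proof (cases "\<exists>x. x \<noteq> r \<and> C x \<noteq> 0")
      case True
      then obtain x where "C x \<ge> 1" "x \<noteq> r" by (auto simp: Suc_le_eq)
      then show ?thesis using exactly_one_of_two_on_target[OF G solvable C 4 _ _ r] by simp
    next
      case False
      then have "{v. C v \<noteq> 0} = {r}" using 4 by auto
      then have "s = 2" using C 4 by (simp add: configuration_def)
      then show ?thesis using solvable two by simp
    qed
  qed
qed

section \<open>The two kinds of vertex sets, and the equality\<close>

text \<open>Used contrapositively: on two isolated vertices no \<open>t\<close> is solvable. A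
  neighbour of \<open>a\<close> can only be \<open>b\<close>.\<close>

lemma connected_if_card_2:
  assumes "sym_digraph G" "loopfree_digraph G" "card (verts G) = 2" "pebbling_solvable G t"
  shows "connected G"
proof -
  interpret sym_digraph G by fact
  obtain a b where ab: "verts G = {a, b}" "a \<noteq> b"
    using assms(3) by (auto simp: card_2_iff)
  obtain v where v: "v \<rightarrow>\<^bsub>G\<^esub> a"
    using pebbling_solvable_imp_adj[OF assms(4), of a b] ab by auto
  have "v \<in> verts G" "v \<noteq> a"
    using v loopfree_digraph.adj_not_same[OF assms(2)] by auto
  then have "b \<rightarrow>\<^bsub>G\<^esub> a" "a \<rightarrow>\<^bsub>G\<^esub> b"
    using v ab graph_symmetric by auto
  then have "u \<rightarrow>\<^sup>*\<^bsub>G\<^esub> w" if "u \<in> verts G" "w \<in> verts G" for u w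
    using that ab by (auto intro: adj_reachable_trans)
  then show ?thesis
    using ab unfolding connected_def
    by (intro strongly_connectedI) (auto intro: reachable_mk_symmetricI)
qed

lemma two_other_vertices:
  assumes "infinite V \<or> card V \<ge> 3"
  obtains a b where "a \<in> V" "b \<in> V" "distinct [r, a, b]"
proof -
  \<comment> \<open>\<open>card\<close> is 0 on infinite sets, hence the separate disjunct; removing
    \<open>r\<close> costs at most one vertex.\<close>
  have "infinite (V - {r}) \<or> 2 \<le> card (V - {r})"
    using assms card_Diff1_le[of V r] by (cases "r \<in> V") auto
  then obtain T where "T \<subseteq> V - {r}" "card T = 2"
    by (metis infinite_arbitrarily_large obtain_subset_with_card_n)
  then show ?thesis using that by (auto simp: card_2_iff)
qed

theorem theorem3p1:
  fixes G :: "('a, 'b) pre_digraph"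
  assumes "simple_graph G"
    and "(infinite (verts G) \<or> card (verts G) \<ge> 3) \<or> (card (verts G) = 2 \<and> \<not> connected G)"
  shows "singular_pebbling_number G = pebbling_number G"
proof -
  have G: "sym_digraph G" "loopfree_digraph G"
    using assms(1) by (auto simp: simple_graph_def)
  \<comment> \<open>Agreement at every \<open>t\<close> makes the least witnesses equal, and also
    covers the case of no witness, where both numbers are \<infinity>.\<close>
  have "(\<forall>s C. s \<ge> t \<and> configuration G s C \<longrightarrow>
      (\<forall>r \<in> verts G. \<exists>C'. pebbling_reachable G C C' \<and> C' r = 1)) \<longleftrightarrow> pebbling_solvable G t"
    (is "?singular \<longleftrightarrow> _") for t
  proof
    assume ?singular
    then show "pebbling_solvable G t"
      unfolding pebbling_solvable_def by (metis order_refl)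
  next
    assume solvable: "pebbling_solvable G t"
    then have big: "infinite (verts G) \<or> card (verts G) \<ge> 3"
      using assms(2) connected_if_card_2[OF G] by blast
    show ?singular
    proof (intro allI impI ballI)
      fix s C r
      assume sC: "s \<ge> t \<and> configuration G s C" and r: "r \<in> verts G"
      obtain a b where ab: "a \<in> verts G" "b \<in> verts G" "distinct [r, a, b]"
        using two_other_vertices[OF big] .
      have "\<not> pebbling_solvable G 2"
        using ab r by (intro not_pebbling_solvable_2[of r a b]) auto
      then show "\<exists>C'. pebbling_reachable G C C' \<and> C' r = 1"
        using exactly_one_on_target[OF G pebbling_solvable_mono[OF _ solvable], of s C r a]
          sC r ab by auto
    qed
  qed
  then show ?thesis
    unfolding singular_pebbling_number_def pebbling_number_def
    by (simp add: pebbling_solvable_def)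
qed

end
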